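(* Let $G$ be a connected $k$-regular graph which has an eigenvector $f:V(G)\to\mathbb{R}$ of the Laplacian $\Delta$, with eigenvalue $\mu>0$, such that there is a constant $c$ with $f(x)-f(y)=\pm c$ for every pair of adjacent vertices $x,y$ of $G$. Then $G$ is bipartite, $\mu=2l$ is an even integer dividing $2k$, the number of vertices of $G$ is divisible by $2^{(k/l)}$, and for $n_0\geq l$ there exist such graphs with $n=2^{(k/l)}n_0$ vertices.
   Context: $G$ is a finite simple connected unweighted graph. The nearest neighbor Laplacian acts on functions $g:V(G)\to\mathbb{R}$ by $\Delta(g)(v)=\sum_{w\sim v}(g(v)-g(w))$; for $k$-regular graphs $\Delta=k\,\mathrm{Id}-A$ with $A$ the adjacency matrix. The constant-gradient condition $f(x)-f(y)=\pm c$ on every edge is the condition that a simple first eigenvector must satisfy when the valuation is maximal for the bottom nonzero eigenvalue $\lambda_1$; the paper notes $c\neq 0$ since otherwise $f$ is constant and has eigenvalue $0$.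
   Formalization: The existence of such graphs with 2^(k/l) n_0 vertices is stated for n_0 ≥ l except when k = 1 and n_0 ≥ 2, where it is false: a connected 1-regular graph is a single edge and has only 2 vertices. *)

theory Defs
  imports Complex_Main "Graph_Theory.Graph_Theory"
begin

text \<open>
  A finite simple graph is a \<^locale>\<open>pair_graph\<close>: a finite, symmetric, loop-free digraph whose
  arcs are ordered pairs of vertices.  Thus an undirected edge is a pair of opposite arcs,
  the degree of a vertex is its out-degree, and a function on the vertex set is represented
  by a total function whose values outside the vertex set are irrelevant.
\<close>

definition regular_graph :: "'a pair_pre_digraph \<Rightarrow> nat \<Rightarrow> bool" where
  "regular_graph G k \<longleftrightarrow> (\<forall>v\<in>pverts G. out_degree (with_proj G) v = k)"

definition bipartite_graph :: "'a pair_pre_digraph \<Rightarrow> bool" where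
  "bipartite_graph G \<longleftrightarrow>
     (\<exists>X Y. X \<union> Y = pverts G \<and> X \<inter> Y = {} \<and>
        (\<forall>(x, y)\<in>parcs G. x \<in> X \<and> y \<in> Y \<or> x \<in> Y \<and> y \<in> X))"

definition laplacian :: "'a pair_pre_digraph \<Rightarrow> ('a \<Rightarrow> real) \<Rightarrow> 'a \<Rightarrow> real" where
  "laplacian G g v = (\<Sum>w | (v, w) \<in> parcs G. g v - g w)"

definition laplacian_eigenvector :: "'a pair_pre_digraph \<Rightarrow> ('a \<Rightarrow> real) \<Rightarrow> real \<Rightarrow> bool" where
  "laplacian_eigenvector G f \<mu> \<longleftrightarrow>
     (\<exists>v\<in>pverts G. f v \<noteq> 0) \<and> (\<forall>v\<in>pverts G. laplacian G f v = \<mu> * f v)"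

definition constant_gradient :: "'a pair_pre_digraph \<Rightarrow> ('a \<Rightarrow> real) \<Rightarrow> real \<Rightarrow> bool" where
  "constant_gradient G f c \<longleftrightarrow> (\<forall>(x, y)\<in>parcs G. f x - f y = c \<or> f x - f y = - c)"

text \<open>The qualified name avoids topological connectedness, which has the same base name.\<close>

definition constant_gradient_graph :: "'a pair_pre_digraph \<Rightarrow> nat \<Rightarrow> real \<Rightarrow> bool" where
  "constant_gradient_graph G k \<mu> \<longleftrightarrow>
     pair_graph G \<and> Digraph_Component.connected (with_proj G) \<and> regular_graph G k \<and> \<mu> > 0 \<and>
     (\<exists>f c. laplacian_eigenvector G f \<mu> \<and> constant_gradient G f c)"

end

theory Submission
  imports Defs
begin

text \<open>
  Let \<open>d v\<close> be the number of neighbours \<open>w\<close> of \<open>v\<close> with \<open>f v - f w = c\<close>, where \<open>c > 0\<close>.  The eigenvalue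
  equation reads \<open>\<mu> * f v = c * (2 * d v - k)\<close>, so \<open>d\<close> changes by \<open>l = \<mu> / 2\<close> along every edge; it
  vanishes where \<open>f\<close> is minimal and equals \<open>k\<close> where \<open>f\<close> is maximal.  Counting the edges between
  the consecutive levels \<open>d = j * l\<close> and \<open>d = (j + 1) * l\<close> shows that level \<open>j\<close> has
  \<open>(k / l choose j)\<close> times as many vertices as level \<open>0\<close>.  Conversely, replace each vertex of the
  \<open>k / l\<close>-dimensional cube by a copy of \<open>\<int> / n0\<close> and each edge by an \<open>l\<close>-regular circulant
  bipartite graph.
\<close>

section \<open>Connected finite simple graphs\<close>

lemma pair_graph_iff:
  "pair_graph G \<longleftrightarrow> finite (pverts G) \<and> parcs G \<subseteq> pverts G \<times> pverts G \<and> sym (parcs G) \<and> irrefl (parcs G)"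
  (is "_ \<longleftrightarrow> ?R")
proof
  assume "pair_graph G"
  then interpret pair_graph G .
  show ?R
    using pair_finite_verts arcs_symmetric no_loops'
    by (auto simp: sym_def irrefl_def intro: in_arcsD1 in_arcsD2)
next
  assume R: ?R
  then have "finite (parcs G)"
    by (meson finite_SigmaI finite_subset)
  with R show "pair_graph G"
    by unfold_locales (auto simp: symmetric_def irrefl_def)
qed

text \<open>Symmetric arcs equal their symmetric closure, and a walk from a vertex never leaves the
  vertex set, so the closure restricted to \<open>pverts G\<close> agrees with the plain
  one.\<close>

lemma (in pair_graph) connected_iff_rtrancl:
  "Digraph_Component.connected (with_proj G) \<longleftrightarrow>
     pverts G \<noteq> {} \<and> pverts G \<times> pverts G \<subseteq> (parcs G)\<^sup>*"
proof -
  have "symcl (parcs G) = parcs G"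
    by (auto simp: symcl_def intro: arcs_symmetric)
  moreover have "(u, v) \<in> rtrancl_on (pverts G) (parcs G)"
    if "u \<in> pverts G" "(u, v) \<in> (parcs G)\<^sup>*" for u v
    using that(2,1)
    by induction (auto intro: rtrancl_on_into_rtrancl_on in_arcsD2)
  moreover have "(u, v) \<in> (parcs G)\<^sup>*" if "(u, v) \<in> rtrancl_on (pverts G) (parcs G)" for u v
    using that by (rule rtrancl_on_rtranclI)
  ultimately show ?thesis
    by (simp add: connected_conv subset_iff) blast
qed

lemma out_degree_with_proj: "out_degree (with_proj G) v = card {w. (v, w) \<in> parcs G}"
proof -
  have "out_arcs (with_proj G) v = Pair v ` {w. (v, w) \<in> parcs G}"
    by (auto simp: out_arcs_def)
  then show ?thesis
    by (simp add: out_degree_def card_image inj_on_def)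
qed

text \<open>Isomorphism invariance, used to relabel a constructed graph by natural numbers. The
  eigenvector is carried over by the inverse of \<open>h\<close>.\<close>

lemma constant_gradient_graph_image:
  assumes G: "constant_gradient_graph G k \<mu>" and h: "inj_on h (pverts G)"
  defines "H \<equiv> \<lparr>pverts = h ` pverts G, parcs = map_prod h h ` parcs G\<rparr>"
  shows "constant_gradient_graph H k \<mu>"
proof -
  from G obtain f c where pg: "pair_graph G" and con: "Digraph_Component.connected (with_proj G)"
    and reg: "regular_graph G k" and \<mu>: "\<mu> > 0" and ev: "laplacian_eigenvector G f \<mu>"
    and cg: "constant_gradient G f c"
    unfolding constant_gradient_graph_def by blast
  from pg interpret pair_graph G .
  have V: "parcs G \<subseteq> pverts G \<times> pverts G" using pg pair_graph_iff by blast
  define g where "g = f \<circ> the_inv_into (pverts G) h"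
  have g: "g (h v) = f v" if "v \<in> pverts G" for v
    using that h by (simp add: g_def the_inv_into_f_f)
  have hE: "(h v, y) \<in> parcs H \<longleftrightarrow> (\<exists>w. (v, w) \<in> parcs G \<and> y = h w)" if "v \<in> pverts G" for v y
    using that h V by (force simp: H_def dest: inj_onD)
  have nbrs: "{y. (h v, y) \<in> parcs H} = h ` {w. (v, w) \<in> parcs G}" if "v \<in> pverts G" for v
    using hE[OF that] by auto
  have inj: "inj_on h {w. (v, w) \<in> parcs G}" for v
    using V by (intro inj_on_subset[OF h]) auto
  have pgH: "pair_graph H"
    unfolding pair_graph_iff
  proof (intro conjI)
    show "irrefl (parcs H)"
      using V h no_loops' by (force simp: H_def irrefl_def dest: inj_onD)
  qed (use V pair_finite_verts arcs_symmetric in \<open>auto simp: H_def sym_def\<close>)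
  have "(h u, h v) \<in> (parcs H)\<^sup>*" if "(u, v) \<in> (parcs G)\<^sup>*" for u v
    using that by induction (auto simp: H_def intro: rtrancl_into_rtrancl)
  then have conH: "Digraph_Component.connected (with_proj H)"
    using con pair_graph.connected_iff_rtrancl[OF pgH] connected_iff_rtrancl
    by (auto simp: H_def)
  have regH: "regular_graph H k"
    using reg nbrs inj
    by (auto simp: regular_graph_def out_degree_with_proj H_def card_image)
  have lap: "laplacian H g (h v) = laplacian G f v" if "v \<in> pverts G" for v
  proof -
    have "laplacian H g (h v) = (\<Sum>w | (v, w) \<in> parcs G. g (h v) - g (h w))"
      unfolding laplacian_def nbrs[OF that] by (simp add: sum.reindex[OF inj])
    also have "\<dots> = laplacian G f v"
      unfolding laplacian_def using V that by (intro sum.cong) (auto simp: g)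
    finally show ?thesis .
  qed
  have evH: "laplacian_eigenvector H g \<mu>"
    using ev lap g by (auto simp: laplacian_eigenvector_def H_def)
  have cgH: "constant_gradient H g c"
    using cg V g by (fastforce simp: constant_gradient_def H_def)
  show ?thesis
    using pgH conH regH \<mu> evH cgH unfolding constant_gradient_graph_def by blast
qed

section \<open>Eigenvectors of constant gradient\<close>

locale gradient_eigenvector = pair_graph +
  fixes k :: nat and \<mu> :: real and f :: "'a \<Rightarrow> real" and c :: real
  assumes con: "Digraph_Component.connected (with_proj G)"
    and reg: "regular_graph G k"
    and \<mu>_pos: "\<mu> > 0"
    and ev: "laplacian_eigenvector G f \<mu>"
    and cg: "constant_gradient G f c"
    and c_nonneg: "c \<ge> 0"
begin

section \<open>Neighbours below and above a vertex\<close>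

definition down :: "'a \<Rightarrow> 'a set" where
  "down v = {w. (v, w) \<in> parcs G \<and> f v - f w = c}"

definition up :: "'a \<Rightarrow> 'a set" where
  "up v = {w. (v, w) \<in> parcs G \<and> f v - f w = - c}"

lemma eigen: "v \<in> pverts G \<Longrightarrow> laplacian G f v = \<mu> * f v"
  using ev by (simp add: laplacian_eigenvector_def)

lemma arc_cases:
  assumes "(v, w) \<in> parcs G"
  obtains "w \<in> down v" "v \<in> up w" | "v \<in> down w" "w \<in> up v"
  using assms cg arcs_symmetric[OF assms] by (fastforce simp: constant_gradient_def down_def up_def)

text \<open>If \<open>c = 0\<close>, every summand of the Laplacian of \<open>f\<close> vanishes, so
  \<mu> > 0 forces \<open>f\<close> to be zero on all vertices.\<close>

lemma c_pos: "c > 0"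
proof (rule ccontr)
  assume "\<not> c > 0"
  with c_nonneg have "c = 0" by simp
  with cg have "laplacian G f v = 0" for v
    unfolding laplacian_def constant_gradient_def by (intro sum.neutral) auto
  with eigen \<mu>_pos have "f v = 0" if "v \<in> pverts G" for v
    using that by fastforce
  with ev show False by (auto simp: laplacian_eigenvector_def)
qed

lemma finite_down: "finite (down v)" and finite_up: "finite (up v)"
  by (auto simp: down_def up_def intro!: finite_subset[OF _ pair_finite_verts] in_arcsD2)

lemma nbrs_eq: "{w. (v, w) \<in> parcs G} = down v \<union> up v"
  by (auto simp: down_def up_def elim: arc_cases)

lemma down_up_disjoint: "down v \<inter> up v = {}"
  using c_pos by (auto simp: down_def up_def)

lemma card_down_up: "v \<in> pverts G \<Longrightarrow> card (down v) + card (up v) = k"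
  using reg card_Un_disjoint[OF finite_down finite_up down_up_disjoint, of v]
  by (simp add: regular_graph_def out_degree_with_proj nbrs_eq)

lemma laplacian_eq:
  assumes "v \<in> pverts G"
  shows "\<mu> * f v = c * (2 * real (card (down v)) - real k)"
proof -
  have "\<mu> * f v = (\<Sum>w\<in>down v \<union> up v. f v - f w)"
    using eigen[OF assms] by (simp add: laplacian_def nbrs_eq)
  also have "\<dots> = (\<Sum>w\<in>down v. f v - f w) + (\<Sum>w\<in>up v. f v - f w)"
    by (rule sum.union_disjoint[OF finite_down finite_up down_up_disjoint])
  also have "\<dots> = (\<Sum>w\<in>down v. c) + (\<Sum>w\<in>up v. - c)"
    by (intro arg_cong2[of _ _ _ _ "(+)"] sum.cong) (auto simp: down_def up_def)
  also have "\<dots> = c * (2 * real (card (down v)) - real k)"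
    by (simp add: card_down_up[OF assms, symmetric] algebra_simps)
  finally show ?thesis .
qed

text \<open>Subtracting the eigenvalue equations at \<open>v\<close> and \<open>w\<close> eliminates
  \<open>k\<close>; the factor \<open>c\<close>, which is positive, then cancels.\<close>

lemma card_down_diff:
  assumes "w \<in> down v"
  shows "\<mu> = 2 * (real (card (down v)) - real (card (down w)))"
proof -
  have V: "v \<in> pverts G" "w \<in> pverts G" and fvw: "f v - f w = c"
    using assms by (auto simp: down_def intro: in_arcsD1 in_arcsD2)
  have "\<mu> * (f v - f w) = c * (2 * (real (card (down v)) - real (card (down w))))"
    unfolding right_diff_distrib[of \<mu>] laplacian_eq[OF V(1)] laplacian_eq[OF V(2)]
    by (simp add: algebra_simps)
  with fvw c_pos show ?thesis by (simp add: mult.commute)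
qed

lemma down_nonempty: "\<exists>v w. w \<in> down v"
proof -
  obtain v where v: "v \<in> pverts G" "f v \<noteq> 0"
    using ev by (auto simp: laplacian_eigenvector_def)
  then have "laplacian G f v \<noteq> 0" using eigen \<mu>_pos by simp
  then have "{w. (v, w) \<in> parcs G} \<noteq> {}" unfolding laplacian_def by (metis sum.empty)
  then show ?thesis by (blast elim: arc_cases)
qed

section \<open>Integrality and divisibility\<close>

definition l :: nat where "l = nat \<lfloor>\<mu> / 2\<rfloor>"

text \<open>Half the eigenvalue is a positive difference of two cardinalities, so the floor in
  \<open>l\<close> is exact. At least one arc exists by \<open>down_nonempty\<close>.\<close>

lemma \<mu>_eq: "\<mu> = 2 * real l"
  and card_down_step: "w \<in> down v \<Longrightarrow> card (down v) = card (down w) + l"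
proof -
  have *: "\<mu> = 2 * real l \<and> card (down v) = card (down w) + l" if "w \<in> down v" for v w
  proof -
    have "\<mu> / 2 = of_int (int (card (down v)) - int (card (down w)))"
      using card_down_diff[OF that] by simp
    moreover have "card (down v) > card (down w)"
      using card_down_diff[OF that] \<mu>_pos by simp
    ultimately show ?thesis
      unfolding l_def using card_down_diff[OF that] by (simp only: floor_of_int) simp
  qed
  then show "w \<in> down v \<Longrightarrow> card (down v) = card (down w) + l" by blast
  show "\<mu> = 2 * real l" using * down_nonempty by blast
qed

lemma l_pos: "l > 0" using \<mu>_eq \<mu>_pos by simp

lemma pverts_nonempty: "pverts G \<noteq> {}"
  using con connected_iff_rtrancl by blast

text \<open>At a minimum of \<open>f\<close> the set \<open>down u\<close> is empty, and each arc
  changes the cardinality by \<open>l\<close>, so divisibility spreads along paths from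
  \<open>u\<close>.\<close>

lemma l_dvd_card_down:
  assumes "v \<in> pverts G"
  shows "l dvd card (down v)"
proof -
  obtain u where u: "u \<in> pverts G" "\<And>w. w \<in> pverts G \<Longrightarrow> f u \<le> f w"
    using finite_has_minimal[of "f ` pverts G"] pair_finite_verts pverts_nonempty
    by (metis (no_types, lifting) arg_min_if_finite(1) arg_min_least)
  then have "down u = {}"
    using c_pos by (fastforce simp: down_def dest: in_arcsD2)
  then have "l dvd card (down u)" by simp
  have "(u, v) \<in> (parcs G)\<^sup>*"
    using con connected_iff_rtrancl u assms by blast
  then show ?thesis
  proof induction
    case base
    show ?case by fact
  next
    case (step y z)
    from step.hyps(2) have "l dvd card (down y) \<longleftrightarrow> l dvd card (down z)"
      by (rule arc_cases) (auto simp: card_down_step)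
    with step.IH show ?case by blast
  qed
qed

text \<open>At a maximum of \<open>f\<close> all \<open>k\<close> neighbours lie below.\<close>

lemma l_dvd_k: "l dvd k"
proof -
  obtain u where u: "u \<in> pverts G" "\<And>w. w \<in> pverts G \<Longrightarrow> f w \<le> f u"
    using arg_min_if_finite(1)[of "pverts G" "\<lambda>v. - f v"] arg_min_least[of "pverts G" _ "\<lambda>v. - f v"]
      pair_finite_verts pverts_nonempty by (metis neg_le_iff_le)
  then have "up u = {}"
    using c_pos by (fastforce simp: up_def dest: in_arcsD2)
  then have "card (down u) = k" using card_down_up[OF u(1)] by simp
  then show ?thesis using l_dvd_card_down[OF u(1)] by simp
qed

text \<open>The parity of the level is a proper 2-colouring, since an edge changes
  \<open>card (down v)\<close> by \<open>l\<close> and hence its quotient by one.\<close>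

lemma bipartite: "bipartite_graph G"
proof -
  define level where "level v = card (down v) div l" for v
  have level: "level v = Suc (level w)" if "w \<in> down v" for v w
    using card_down_step[OF that] l_pos by (simp add: level_def)
  let ?X = "{v \<in> pverts G. even (level v)}" and ?Y = "{v \<in> pverts G. odd (level v)}"
  have "x \<in> ?X \<and> y \<in> ?Y \<or> x \<in> ?Y \<and> y \<in> ?X" if xy: "(x, y) \<in> parcs G" for x y
  proof -
    from xy have "level x = Suc (level y) \<or> level y = Suc (level x)"
      by (rule arc_cases) (simp_all add: level)
    with in_arcsD1[OF xy] in_arcsD2[OF xy] show ?thesis by auto
  qed
  then show ?thesis
    unfolding bipartite_graph_def by (intro exI[of _ ?X] exI[of _ ?Y]) auto
qed

section \<open>Counting the vertices level by level\<close>

definition level_set :: "nat \<Rightarrow> 'a set" where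
  "level_set j = {v \<in> pverts G. card (down v) = j * l}"

text \<open>Double counting of the edges between two consecutive levels: an upper vertex has
  \<open>Suc j * l\<close> neighbours below, a lower one has \<open>k - j * l\<close> above.\<close>

lemma card_level_set_Suc:
  "Suc j * card (level_set (Suc j)) = (k div l - j) * card (level_set j)"
proof -
  have fin: "finite (level_set i)" for i
    using pair_finite_verts by (simp add: level_set_def)
  have down: "w \<in> level_set j \<and> v \<in> up w" if "v \<in> level_set (Suc j)" "w \<in> down v" for v w
    using that card_down_step[OF that(2)]
    by (auto simp: level_set_def down_def up_def intro: in_arcsD2 arcs_symmetric)
  have up: "v \<in> level_set (Suc j) \<and> w \<in> down v" if "w \<in> level_set j" "v \<in> up w" for v w
  proof -
    have "w \<in> down v" using that(2) by (auto simp: down_def up_def intro: arcs_symmetric)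
    with that card_down_step[OF this] show ?thesis
      by (auto simp: level_set_def up_def intro: in_arcsD2)
  qed
  have "Sigma (level_set (Suc j)) down = prod.swap ` Sigma (level_set j) up"
  proof (intro equalityI subsetI)
    fix x assume "x \<in> Sigma (level_set (Suc j)) down"
    then show "x \<in> prod.swap ` Sigma (level_set j) up"
      using down by auto
  next
    fix x assume "x \<in> prod.swap ` Sigma (level_set j) up"
    then show "x \<in> Sigma (level_set (Suc j)) down"
      using up by auto
  qed
  then have "card (Sigma (level_set (Suc j)) down) = card (Sigma (level_set j) up)"
    by (simp add: card_image)
  moreover have "card (up w) = (k div l - j) * l" if "w \<in> level_set j" for w
  proof -
    have "card (up w) = k - j * l"
      using that card_down_up[of w] by (simp add: level_set_def)
    then show ?thesis using l_dvd_k by (simp add: diff_mult_distrib)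
  qed
  moreover have "card (down v) = Suc j * l" if "v \<in> level_set (Suc j)" for v
    using that by (simp add: level_set_def)
  ultimately have "card (level_set (Suc j)) * (Suc j * l) = card (level_set j) * ((k div l - j) * l)"
    by (simp add: card_SigmaI fin finite_down finite_up)
  then have "l * (Suc j * card (level_set (Suc j))) = l * ((k div l - j) * card (level_set j))"
    by (simp only: ac_simps)
  then show ?thesis using l_pos by (simp only: mult_cancel1) simp
qed

text \<open>The recursion between levels is the absorption identity for binomial coefficients, after
  cancelling \<open>Suc j\<close>.\<close>

lemma card_level_set: "card (level_set j) = (k div l choose j) * card (level_set 0)"
proof (induction j)
  case (Suc j)
  have "Suc j * card (level_set (Suc j)) = ((k div l - j) * (k div l choose j)) * card (level_set 0)"
    using card_level_set_Suc[of j] Suc by simp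
  also have "(k div l - j) * (k div l choose j) = Suc j * (k div l choose Suc j)"
    by (simp only: binomial_absorb_comp binomial_absorption)
  finally show ?case by (simp only: mult.assoc mult_cancel1) simp
qed simp

text \<open>The levels 0 to \<open>k div l\<close> partition the vertices, and a row of binomial
  coefficients sums to a power of two.\<close>

lemma card_pverts: "card (pverts G) = 2 ^ (k div l) * card (level_set 0)"
proof -
  have "pverts G = (\<Union>j\<le>k div l. level_set j)"
  proof (intro equalityI subsetI)
    fix v assume v: "v \<in> pverts G"
    have "card (down v) \<le> k" using card_down_up[OF v] by simp
    then have "card (down v) div l \<le> k div l" by (rule div_le_mono)
    moreover have "v \<in> level_set (card (down v) div l)"
      using v l_dvd_card_down[OF v] by (simp add: level_set_def)
    ultimately show "v \<in> (\<Union>j\<le>k div l. level_set j)" by blast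
  qed (auto simp: level_set_def)
  also have "card \<dots> = (\<Sum>j\<le>k div l. card (level_set j))"
    using pair_finite_verts l_pos by (intro card_UN_disjoint) (auto simp: level_set_def)
  also have "\<dots> = (\<Sum>j\<le>k div l. (k div l choose j)) * card (level_set 0)"
    by (subst card_level_set) (simp add: sum_distrib_right)
  also have "(\<Sum>j\<le>k div l. (k div l choose j)) = 2 ^ (k div l)"
    by (rule choose_row_sum)
  finally show ?thesis .
qed

end

text \<open>The gradient condition does not depend on the sign of \<open>c\<close>, so
  \<open>\<bar>c\<bar>\<close> may replace it.\<close>

lemma constant_gradient_graphE:
  assumes "constant_gradient_graph G k \<mu>"
  obtains f c where "gradient_eigenvector G k \<mu> f c"
proof -
  from assms obtain f c where *: "pair_graph G" "Digraph_Component.connected (with_proj G)"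
    "regular_graph G k" "\<mu> > 0" "laplacian_eigenvector G f \<mu>" "constant_gradient G f c"
    unfolding constant_gradient_graph_def by blast
  then have "constant_gradient G f \<bar>c\<bar>"
    by (auto simp: constant_gradient_def abs_if)
  with * have "gradient_eigenvector G k \<mu> f \<bar>c\<bar>"
    by (simp add: gradient_eigenvector_def gradient_eigenvector_axioms_def)
  then show thesis by (rule that)
qed

lemma constant_gradient_graph_bipartite:
  assumes "constant_gradient_graph G k \<mu>"
  shows "bipartite_graph G"
  using assms by (auto elim: constant_gradient_graphE intro: gradient_eigenvector.bipartite)

lemma constant_gradient_graph_card:
  assumes "constant_gradient_graph G k \<mu>"
  shows "\<exists>l. \<mu> = 2 * real l \<and> 2 * l dvd 2 * k \<and> 2 ^ (k div l) dvd card (pverts G)"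
proof -
  from assms obtain f c where "gradient_eigenvector G k \<mu> f c"
    by (rule constant_gradient_graphE)
  then interpret gradient_eigenvector G k \<mu> f c .
  show ?thesis
    using \<mu>_eq l_dvd_k card_pverts by (intro exI[of _ l]) simp
qed

section \<open>Twisted blow-ups of the hypercube\<close>

text \<open>\<open>U\<close> holds the edges directed upwards in the rank \<open>h\<close>. With
  \<open>f v = 2 * h v - m\<close>, the \<open>(m - h v) * l\<close> upper neighbours contribute -2
  each and the \<open>h v * l\<close> lower ones 2 each, which adds up to
  \<open>2 * l * f v\<close>.\<close>

lemma constant_gradient_graph_of_grading:
  fixes V :: "'v set" and h :: "'v \<Rightarrow> nat"
  assumes fin: "finite V" and sub: "U \<subseteq> V \<times> V" and m: "m > 0" and l: "l > 0"
    and grade: "\<And>v w. (v, w) \<in> U \<Longrightarrow> h w = Suc (h v)"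
    and h_le: "\<And>v. v \<in> V \<Longrightarrow> h v \<le> m"
    and up: "\<And>v. v \<in> V \<Longrightarrow> card {w. (v, w) \<in> U} = (m - h v) * l"
    and down: "\<And>v. v \<in> V \<Longrightarrow> card {w. (w, v) \<in> U} = h v * l"
    and v0: "v0 \<in> V" "h v0 = 0"
    and con: "\<And>v. v \<in> V \<Longrightarrow> (v0, v) \<in> (U \<union> U\<inverse>)\<^sup>*"
  shows "constant_gradient_graph \<lparr>pverts = V, parcs = U \<union> U\<inverse>\<rparr> (m * l) (2 * real l)"
proof -
  let ?G = "\<lparr>pverts = V, parcs = U \<union> U\<inverse>\<rparr>"
  define f where "f v = 2 * real (h v) - real m" for v
  have pg: "pair_graph ?G"
    unfolding pair_graph_iff using fin sub by (auto simp: sym_def irrefl_def dest: grade)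
  have "sym ((U \<union> U\<inverse>)\<^sup>*)" by (intro sym_rtrancl) (auto simp: sym_def)
  then have "(v, w) \<in> (U \<union> U\<inverse>)\<^sup>*" if "v \<in> V" "w \<in> V" for v w
    using con[OF that(1)] con[OF that(2)] by (meson rtrancl_trans symD)
  then have conG: "Digraph_Component.connected (with_proj ?G)"
    using v0 by (auto simp: pair_graph.connected_iff_rtrancl[OF pg])
  have nbrs: "{w. (v, w) \<in> U \<union> U\<inverse>} = {w. (v, w) \<in> U} \<union> {w. (w, v) \<in> U}" for v
    by auto
  have fins: "finite {w. (v, w) \<in> U}" "finite {w. (w, v) \<in> U}" for v
    using sub by (auto intro!: finite_subset[OF _ fin])
  have disj: "{w. (v, w) \<in> U} \<inter> {w. (w, v) \<in> U} = {}" for v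
    by (auto dest!: grade)
  have reg: "regular_graph ?G (m * l)"
    using h_le
    by (auto simp: regular_graph_def out_degree_with_proj nbrs[simplified] card_Un_disjoint[OF fins disj]
        up down simp flip: add_mult_distrib)
  have "laplacian ?G f v = 2 * real l * f v" if v: "v \<in> V" for v
  proof -
    have "laplacian ?G f v = (\<Sum>w\<in>{w. (v, w) \<in> U} \<union> {w. (w, v) \<in> U}. f v - f w)"
      by (simp add: laplacian_def nbrs[simplified])
    also have "\<dots> = (\<Sum>w | (v, w) \<in> U. f v - f w) + (\<Sum>w | (w, v) \<in> U. f v - f w)"
      by (rule sum.union_disjoint[OF fins disj])
    also have "\<dots> = (\<Sum>w | (v, w) \<in> U. - 2) + (\<Sum>w | (w, v) \<in> U. 2)"
      by (intro arg_cong2[of _ _ _ _ "(+)"] sum.cong) (auto simp: f_def dest!: grade)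
    also have "\<dots> = 2 * real l * f v"
      using h_le[OF v] by (simp add: up[OF v] down[OF v] f_def of_nat_diff algebra_simps)
    finally show ?thesis .
  qed
  moreover have "f v0 \<noteq> 0" using v0 m by (simp add: f_def)
  ultimately have evG: "laplacian_eigenvector ?G f (2 * real l)"
    using v0 by (auto simp: laplacian_eigenvector_def)
  have "constant_gradient ?G f 2"
    by (auto simp: constant_gradient_def f_def dest!: grade)
  then show ?thesis
    using pg conG reg evG l unfolding constant_gradient_graph_def by auto
qed

section \<open>Windows of residues modulo n\<close>

lemma mod_diff_diff_simps:
  fixes x y t n :: int
  shows "(x mod n - y - t) mod n = (x - y - t) mod n"
    and "(x - y mod n - t) mod n = (x - y - t) mod n"
proof -
  show "(x mod n - y - t) mod n = (x - y - t) mod n"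
    using mod_diff_left_eq[of x n "y + t"] by (simp add: diff_diff_eq)
  show "(x - y mod n - t) mod n = (x - y - t) mod n"
    using mod_diff_right_eq[of "x - t" y n] by (simp add: algebra_simps)
qed

text \<open>Translation or reflection maps \<open>{0..<l}\<close> onto the solutions, injectively
  because \<open>l \<le> n\<close>. These are the degrees of the circulant bipartite graph seen from
  its two sides.\<close>

lemma card_mod_less:
  fixes n u :: int
  assumes "int l \<le> n" "n > 0"
  shows "card {j \<in> {0..<n}. (j - u) mod n < int l} = l"
    and "card {j \<in> {0..<n}. (u - j) mod n < int l} = l"
proof -
  have "bij_betw (\<lambda>t. (t + u) mod n) {0..<int l} {j \<in> {0..<n}. (j - u) mod n < int l}"
    by (rule bij_betw_byWitness[where f' = "\<lambda>j. (j - u) mod n"])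
      (use assms in \<open>auto simp: mod_simps\<close>)
  then show "card {j \<in> {0..<n}. (j - u) mod n < int l} = l"
    using bij_betw_same_card by fastforce
  have "bij_betw (\<lambda>t. (u - t) mod n) {0..<int l} {j \<in> {0..<n}. (u - j) mod n < int l}"
    by (rule bij_betw_byWitness[where f' = "\<lambda>j. (u - j) mod n"])
      (use assms in \<open>auto simp: mod_simps\<close>)
  then show "card {j \<in> {0..<n}. (u - j) mod n < int l} = l"
    using bij_betw_same_card by fastforce
qed

text \<open>Here \<open>m\<close> stands for \<open>k / l\<close> and \<open>n\<close> for
  \<open>n0\<close>. If \<open>m * l = 1\<close> the graph is a perfect matching, connected only for
  \<open>n = 1\<close>.\<close>

locale twisted_cube =
  fixes m l :: nat and n :: int
  assumes m: "m > 0" and l: "l > 0" and l_le: "int l \<le> n"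
    and nontrivial: "m * l = 1 \<Longrightarrow> n = 1"
begin

text \<open>For \<open>l = 1\<close> the blow-up without a twist would be \<open>n\<close> disjoint copies of the hypercube;
  twisting a single edge, which lies on a cycle as soon as \<open>m \<ge> 2\<close>, connects them.\<close>

definition twist :: "nat set \<Rightarrow> nat \<Rightarrow> int" where
  "twist S a = (if S = {} \<and> a = 0 then 1 else 0)"

definition V :: "(nat set \<times> int) set" where
  "V = Pow {..<m} \<times> {0..<n}"

text \<open>Over a cube edge from \<open>S\<close> to \<open>insert a S\<close>, the point
  \<open>i\<close> is joined to the \<open>l\<close> cyclically consecutive residues starting at
  \<open>i + twist S a\<close>.\<close>

definition U :: "((nat set \<times> int) \<times> (nat set \<times> int)) set" where
  "U = {((S, i), (insert a S, j)) | S a i j. S \<subseteq> {..<m} \<and> a < m \<and> a \<notin> S \<and>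
          i \<in> {0..<n} \<and> j \<in> {0..<n} \<and> (j - i - twist S a) mod n < int l}"

lemma n_pos: "n > 0" using l l_le by simp

text \<open>The two sets determine the added element, which removes the existential quantifier over
  \<open>a\<close> in \<open>U\<close>.\<close>

lemma in_U_insert:
  assumes "a \<notin> S"
  shows "((S, i), (insert a S, j)) \<in> U \<longleftrightarrow> insert a S \<subseteq> {..<m} \<and>
    i \<in> {0..<n} \<and> j \<in> {0..<n} \<and> (j - i - twist S a) mod n < int l"
proof -
  have "insert a S = insert a' S \<longleftrightarrow> a' = a" for a'
  proof
    assume "insert a S = insert a' S"
    then have "a \<in> insert a' S" by auto
    with assms show "a' = a" by simp
  qed simp
  then show ?thesis using assms by (auto simp: U_def)
qed

text \<open>There are \<open>m - card S\<close> elements to add, each leading to a window of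
  \<open>l\<close> residues.\<close>

lemma card_up:
  assumes "(S, i) \<in> V"
  shows "card {w. ((S, i), w) \<in> U} = (m - card S) * l"
proof -
  let ?J = "\<lambda>a. {j \<in> {0..<n}. (j - (i + twist S a)) mod n < int l}"
  have "{w. ((S, i), w) \<in> U} = (\<lambda>(a, j). (insert a S, j)) ` Sigma ({..<m} - S) ?J"
    using assms by (force simp: U_def V_def algebra_simps)
  moreover have "inj_on (\<lambda>(a, j). (insert a S, j)) (Sigma ({..<m} - S) ?J)"
    by (auto simp: inj_on_def)
  moreover have "finite (?J a)" for a
    by (rule finite_subset[of _ "{0..<n}"]) auto
  ultimately have "card {w. ((S, i), w) \<in> U} = (\<Sum>a\<in>{..<m} - S. card (?J a))"
    by (simp add: card_image card_SigmaI del: atLeastLessThan_iff)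
  then show ?thesis
    using assms by (simp add: card_mod_less[OF l_le n_pos] card_Diff_subset[OF finite_subset[of _ "{..<m}"]] V_def del: atLeastLessThan_iff)
qed

text \<open>Dual to \<open>card_up\<close>: an element of \<open>S\<close> is removed, and the twist
  is read off at the smaller set \<open>S - {a}\<close>.\<close>

lemma card_down:
  assumes "(S, i) \<in> V"
  shows "card {w. (w, (S, i)) \<in> U} = card S * l"
proof -
  let ?J = "\<lambda>a. {j \<in> {0..<n}. (i - twist (S - {a}) a - j) mod n < int l}"
  have S: "S \<subseteq> {..<m}" "finite S" using assms by (auto simp: V_def finite_subset)
  have "{w. (w, (S, i)) \<in> U} = (\<lambda>(a, j). (S - {a}, j)) ` Sigma S ?J"
  proof (intro equalityI subsetI)
    fix w assume "w \<in> {w. (w, (S, i)) \<in> U}"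
    then obtain T a j where "w = (T, j)" "S = insert a T" "a \<notin> T" "j \<in> {0..<n}"
      "(i - j - twist T a) mod n < int l"
      by (auto simp: U_def)
    then show "w \<in> (\<lambda>(a, j). (S - {a}, j)) ` Sigma S ?J"
      by (intro image_eqI[of _ _ "(a, j)"]) (auto simp: algebra_simps)
  next
    fix w assume "w \<in> (\<lambda>(a, j). (S - {a}, j)) ` Sigma S ?J"
    then obtain a j where "a \<in> S" "j \<in> ?J a" "w = (S - {a}, j)" by auto
    then show "w \<in> {w. (w, (S, i)) \<in> U}"
      using in_U_insert[of a "S - {a}" j i] assms
      by (auto simp: insert_absorb V_def algebra_simps)
  qed
  moreover have "inj_on (\<lambda>(a, j). (S - {a}, j)) (Sigma S ?J)"
    by (auto simp: inj_on_def)
  moreover have "finite (?J a)" for a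
    by (rule finite_subset[of _ "{0..<n}"]) auto
  ultimately have "card {w. (w, (S, i)) \<in> U} = (\<Sum>a\<in>S. card (?J a))"
    using S by (simp add: card_image card_SigmaI del: atLeastLessThan_iff)
  then show ?thesis
    by (simp add: card_mod_less[OF l_le n_pos] del: atLeastLessThan_iff)
qed

section \<open>Connectedness of the twisted cube\<close>

abbreviation conn :: "((nat set \<times> int) \<times> (nat set \<times> int)) set" where
  "conn \<equiv> (U \<union> U\<inverse>)\<^sup>*"

lemma conn_sym: "(v, w) \<in> conn \<Longrightarrow> (w, v) \<in> conn"
  by (rule symD[OF sym_rtrancl]) (auto simp: sym_def)

lemma U_conn: "(v, w) \<in> U \<Longrightarrow> (v, w) \<in> conn"
  by auto

lemma conn_shift:
  assumes i: "i \<in> {0..<n}"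
  shows "(({}, i), ({}, (i + 1) mod n)) \<in> conn"
proof -
  let ?i = "(i + 1) mod n"
  have i': "?i \<in> {0..<n}" using n_pos by simp
  \<comment> \<open>The remaining case \<open>l = m = 1\<close> falls under \<open>n = 1\<close> by
    \<open>nontrivial\<close>.\<close>
  consider "l \<ge> 2" | "l = 1" "m \<ge> 2" | "n = 1"
    using l m nontrivial by (cases "l \<ge> 2"; cases "m \<ge> 2") (auto simp: not_le less_2_cases_iff)
  then show ?thesis
  proof cases
    case 1
    have "1 mod n < int l" using 1 n_pos zmod_le_nonneg_dividend[of 1 n] by linarith
    \<comment> \<open>Consecutive points over the empty set share a neighbour: past the twist of 1,
      \<open>i + 2\<close> has offset 1 from \<open>i\<close> and offset 0 from
      \<open>i + 1\<close>.\<close>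
    then have "(({}, i), ({0}, (i + 2) mod n)) \<in> U"
      using in_U_insert[of 0 "{}" i "(i + 2) mod n"] i n_pos m
      by (simp add: twist_def mod_diff_diff_simps)
    moreover have "(({}, ?i), ({0}, (i + 2) mod n)) \<in> U"
      using in_U_insert[of 0 "{}" ?i "(i + 2) mod n"] i n_pos m l
      by (simp add: twist_def mod_diff_diff_simps)
    ultimately show ?thesis by (meson U_conn conn_sym rtrancl_trans)
  next
    case 2
    \<comment> \<open>A lap around the square with corners \<open>{}\<close>, \<open>{0}\<close>,
      \<open>{1, 0}\<close>, \<open>{1}\<close> crosses the twisted edge once, so it returns shifted
      by 1.\<close>
    have "(({}, i), ({0}, ?i)) \<in> U"
      using in_U_insert[of 0 "{}" i ?i] i n_pos m l by (simp add: twist_def mod_diff_diff_simps)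
    moreover have "(({0}, ?i), ({1, 0}, ?i)) \<in> U"
      using in_U_insert[of 1 "{0}" ?i ?i] i' 2 by (simp add: twist_def)
    moreover have "(({1}, ?i), ({1, 0}, ?i)) \<in> U"
      using in_U_insert[of 0 "{1}" ?i ?i] i' 2 by (simp add: twist_def insert_commute)
    moreover have "(({}, ?i), ({1}, ?i)) \<in> U"
      using in_U_insert[of 1 "{}" ?i ?i] i' 2 by (simp add: twist_def)
    ultimately show ?thesis by (meson U_conn conn_sym rtrancl_trans)
  next
    case 3
    with i have "(i + 1) mod n = i" by auto
    then show ?thesis by simp
  qed
qed

lemma conn_empty:
  assumes "int t < n"
  shows "(({}, 0), ({}, int t)) \<in> conn"
  using assms
proof (induction t)
  case (Suc t)
  then have "(({}, 0), ({}, int t)) \<in> conn" by simp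
  also have "(({}, int t), ({}, (int t + 1) mod n)) \<in> conn"
    using Suc.prems by (intro conn_shift) simp
  also have "(int t + 1) mod n = int (Suc t)" using Suc.prems by simp
  finally show ?case .
qed simp

text \<open>Removing elements one at a time leads from any vertex down to the fibre over the empty
  set, which \<open>conn_empty\<close> connects.\<close>

lemma conn_all:
  assumes "v \<in> V"
  shows "(({}, 0), v) \<in> conn"
proof -
  have "(({}, 0), (S, i)) \<in> conn" if "finite S" "S \<subseteq> {..<m}" "i \<in> {0..<n}" for S i
    using that
  proof (induction S arbitrary: i)
    case empty
    then show ?case using conn_empty[of "nat i"] by simp
  next
    case (insert a S)
    \<comment> \<open>The lower neighbour with offset 0, admissible for every
      \<open>l > 0\<close>.\<close>
    let ?j = "(i - twist S a) mod n"
    have "(({}, 0), (S, ?j)) \<in> conn"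
      using insert n_pos by simp
    also have "((S, ?j), (insert a S, i)) \<in> conn"
      using in_U_insert[of a S ?j i] insert n_pos l
      by (intro U_conn) (simp add: mod_diff_diff_simps)
    finally show ?case .
  qed
  with assms show ?thesis by (auto simp: V_def finite_subset)
qed

lemma constant_gradient:
  "constant_gradient_graph \<lparr>pverts = V, parcs = U \<union> U\<inverse>\<rparr> (m * l) (2 * real l)"
\<comment> \<open>The rank of a vertex is that of its cube coordinate, the cardinality of the
  set.\<close>
proof (rule constant_gradient_graph_of_grading[where h = "card \<circ> fst" and ?v0.0 = "({}, 0)"])
  show "U \<subseteq> V \<times> V" by (auto simp: U_def V_def)
  show "(card \<circ> fst) w = Suc ((card \<circ> fst) v)" if "(v, w) \<in> U" for v w
    using that by (auto simp: U_def finite_subset)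
  show "(card \<circ> fst) v \<le> m" if "v \<in> V" for v
    using that card_mono[of "{..<m}" "fst v"] by (auto simp: V_def)
  show "card {w. (v, w) \<in> U} = (m - (card \<circ> fst) v) * l" if "v \<in> V" for v
    using that card_up[of "fst v" "snd v"] by simp
  show "card {w. (w, v) \<in> U} = (card \<circ> fst) v * l" if "v \<in> V" for v
    using that card_down[of "fst v" "snd v"] by simp
  show "(({}, 0), v) \<in> conn" if "v \<in> V" for v
    using that by (rule conn_all)
qed (use m l n_pos in \<open>simp_all add: V_def\<close>)

lemma card_V: "card V = 2 ^ m * nat n"
  by (simp add: V_def card_cartesian_product card_Pow)

end

lemma constant_gradient_graph_exists:
  assumes "m > 0" "l > 0" "l \<le> n0" "m * l = 1 \<Longrightarrow> n0 = 1"
  shows "\<exists>H :: nat pair_pre_digraph.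
    constant_gradient_graph H (m * l) (2 * real l) \<and> card (pverts H) = 2 ^ m * n0"
proof -
  interpret twisted_cube m l "int n0"
    using assms by unfold_locales auto
  have "finite V" by (simp add: V_def)
  then obtain h :: "nat set \<times> int \<Rightarrow> nat" where h: "inj_on h V"
    using finite_imp_inj_to_nat_seg by blast
  with constant_gradient_graph_image[OF constant_gradient, of h] show ?thesis
    by (intro exI conjI) (auto simp: card_image card_V)
qed

(* The premise "k = 1 --> n0 = 1" excludes only the impossible case of a connected
   1-regular graph (necessarily a single edge) on more than two vertices. *)
theorem theorem13:
  shows "(\<forall>(G :: 'a pair_pre_digraph) (k :: nat) (\<mu> :: real).
            constant_gradient_graph G k \<mu> \<longrightarrow>
              bipartite_graph G \<and>
              (\<exists>l :: nat. \<mu> = 2 * real l \<and> 2 * l dvd 2 * k \<and>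
                 2 ^ (k div l) dvd card (pverts G))) \<and>
         (\<forall>(k :: nat) (l :: nat) (n0 :: nat).
            k > 0 \<longrightarrow> l > 0 \<longrightarrow> 2 * l dvd 2 * k \<longrightarrow> n0 \<ge> l \<longrightarrow> (k = 1 \<longrightarrow> n0 = 1) \<longrightarrow>
              (\<exists>H :: nat pair_pre_digraph.
                 constant_gradient_graph H k (2 * real l) \<and>
                 card (pverts H) = 2 ^ (k div l) * n0))"
proof (intro conjI allI impI, goal_cases)
  case (1 G k \<mu>)
  then show ?case by (rule constant_gradient_graph_bipartite)
next
  case (2 G k \<mu>)
  then show ?case by (rule constant_gradient_graph_card)
next
  case (3 k l n0)
  then have "l dvd k" by simp
  with 3 have "k = (k div l) * l" "k div l > 0" by (auto intro: Nat.gr0I)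
  with 3 have *: "0 < k div l" "0 < l" "l \<le> n0" "k div l * l = 1 \<Longrightarrow> n0 = 1" "k div l * l = k"
    by auto
  from constant_gradient_graph_exists[OF *(1-4)] show ?case
    unfolding *(5) .
qed

end
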